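(* Let $\left([(f_n,g_n)]_{\approx}\right)_{n\in\mathbb N}$ be a sequence of integrability--witnessing expectations and suppose a limit of this sequence exists. Then that limit is unique, i.e.\ if $[(f,g)]_{\approx}$ and $[(f',g')]_{\approx}$ are both limits of $\left([(f_n,g_n)]_{\approx}\right)_{n\in\mathbb N}$, then $[(f,g)]_{\approx}=[(f',g')]_{\approx}$.
   Context: Let $\Sigma$ be a set of program states. Let $\mathbb{E}^{\star}$ be the set of functions $\Sigma\to\mathbb R$ and $\mathbb{E}_{\geq 0}^{\infty}$ the set of functions $\Sigma\to[0,\infty]$. Let $\mathbb P=\{(f,g)\mid f\in\mathbb{E}^{\star},\,g\in\mathbb{E}_{\geq 0}^{\infty},\,|f|\le g\}$. Define the quasi-order $(f,g)\precsim(f',g')$ iff for all $\sigma$, $g'(\sigma)\neq\infty$ implies $f(\sigma)\le f'(\sigma)$ and $g(\sigma)\le g'(\sigma)$, and let $\approx\,=\,\precsim\cap\succsim$; equivalently $(f,g)\approx(f',g')$ iff for all $\sigma$, ($g(\sigma)\ne\infty$ or $g'(\sigma)\ne\infty$) implies $f(\sigma)=f'(\sigma)$ and $g(\sigma)=g'(\sigma)$. Write $[(f,g)]_{\approx}$ for the equivalence class of $(f,g)$ under $\approx$ (an integrability--witnessing expectation), and $\mathbb{IE}$ for the set of these classes. A class $[(f,g)]_{\approx}$ is a limit of a sequence $\left([(f_n,g_n)]_{\approx}\right)_{n\in\mathbb N}$ if there exist representatives $(f_n',g_n')\in[(f_n,g_n)]_{\approx}$ with $g(\sigma)=\lim_{n\to\omega}g_n'(\sigma)$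 for all $\sigma$ ($\infty$ being an admissible limit) and $f(\sigma)=\lim_{n\to\omega}f_n'(\sigma)$ whenever $\lim_{n\to\omega}g_n'(\sigma)\ne\infty$, and $f(\sigma)=0$ otherwise. *)

theory Defs
  imports "HOL-Library.Extended_Nonnegative_Real"
begin

type_synonym 's iw_pair = "('s \<Rightarrow> real) \<times> ('s \<Rightarrow> ennreal)"

definition iw_pairs :: "'s iw_pair set" where
  "iw_pairs = {(f, g). \<forall>\<sigma>. ennreal \<bar>f \<sigma>\<bar> \<le> g \<sigma>}"

definition iw_le :: "'s iw_pair rel" where
  "iw_le = {((f, g), (f', g')). (f, g) \<in> iw_pairs \<and> (f', g') \<in> iw_pairs \<and>
     (\<forall>\<sigma>. g' \<sigma> \<noteq> \<infinity> \<longrightarrow> f \<sigma> \<le> f' \<sigma> \<and> g \<sigma> \<le> g' \<sigma>)}"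

definition iw_equiv :: "'s iw_pair rel" where
  "iw_equiv = iw_le \<inter> iw_le\<inverse>"

lemma refl_on_iw_le: "refl_on iw_pairs iw_le"
  by (auto simp: refl_on_def iw_le_def)

lemma trans_iw_le: "trans iw_le"
proof (rule transI)
  fix p q r :: "'s iw_pair"
  assume pq: "(p, q) \<in> iw_le" and qr: "(q, r) \<in> iw_le"
  obtain f g f' g' f'' g'' where [simp]: "p = (f, g)" "q = (f', g')" "r = (f'', g'')"
    by (metis surj_pair)
  have "f \<sigma> \<le> f'' \<sigma> \<and> g \<sigma> \<le> g'' \<sigma>" if fin: "g'' \<sigma> \<noteq> \<infinity>" for \<sigma>
  proof -
    have 1: "f' \<sigma> \<le> f'' \<sigma>" "g' \<sigma> \<le> g'' \<sigma>"
      using qr fin by (auto simp: iw_le_def)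
    then have "g' \<sigma> \<noteq> \<infinity>"
      using fin by (auto simp: top_unique)
    then have "f \<sigma> \<le> f' \<sigma>" "g \<sigma> \<le> g' \<sigma>"
      using pq by (auto simp: iw_le_def)
    with 1 show ?thesis by (meson order_trans)
  qed
  with pq qr show "(p, r) \<in> iw_le" by (auto simp: iw_le_def)
qed

lemma equiv_iw_equiv: "equiv iw_pairs iw_equiv"
proof (rule equivI)
  show "iw_equiv \<subseteq> iw_pairs \<times> iw_pairs"
    by (auto simp: iw_equiv_def iw_le_def)
  show "refl_on iw_pairs iw_equiv"
    using refl_on_iw_le by (auto simp: iw_equiv_def refl_on_def)
  show "sym iw_equiv"
    by (auto simp: iw_equiv_def sym_def)
  show "trans iw_equiv"
    unfolding iw_equiv_def by (intro trans_Int trans_iw_le) (simp add: trans_iw_le)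
qed

lemma iw_equiv_iff:
  "((f, g), (f', g')) \<in> iw_equiv \<longleftrightarrow>
     (f, g) \<in> iw_pairs \<and> (f', g') \<in> iw_pairs \<and>
     (\<forall>\<sigma>. g \<sigma> \<noteq> \<infinity> \<or> g' \<sigma> \<noteq> \<infinity> \<longrightarrow> f \<sigma> = f' \<sigma> \<and> g \<sigma> = g' \<sigma>)"
  unfolding iw_equiv_def iw_le_def
  by (auto simp: top_unique) (metis antisym top_unique)+

definition iw_class :: "'s iw_pair \<Rightarrow> 's iw_pair set" where
  "iw_class p = iw_equiv `` {p}"

definition iw_expectations :: "'s iw_pair set set" where
  "iw_expectations = iw_pairs // iw_equiv"

(* The clause "f \<sigma> = 0" is not invariant under iw_equiv, so the limit has to be witnessed
   by a suitable representative (f, g) of L.  In the last conjunct g \<sigma> stands for the limit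
   of gs n \<sigma>. *)
definition iw_limit :: "(nat \<Rightarrow> 's iw_pair set) \<Rightarrow> 's iw_pair set \<Rightarrow> bool" where
  "iw_limit X L \<longleftrightarrow>
     (\<exists>f g fs gs. (f, g) \<in> L \<and> (\<forall>n. (fs n, gs n) \<in> X n) \<and>
        (\<forall>\<sigma>. (\<lambda>n. gs n \<sigma>) \<longlonglongrightarrow> g \<sigma>) \<and>
        (\<forall>\<sigma>. if g \<sigma> \<noteq> \<infinity> then (\<lambda>n. fs n \<sigma>) \<longlonglongrightarrow> f \<sigma> else f \<sigma> = 0))"

end

theory Submission
  imports Defs
begin

text \<open>Equivalent pairs have the same second component and agree in the first one wherever
  the second is finite. Hence representatives of the two limit processes have the same
  \<open>g\<close>-sequence, and where its limit is finite, their \<open>f\<close>-sequences eventually coincide.\<close>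

text \<open>If either value is finite, \<open>iw_equiv_iff\<close> forces equality; otherwise both
  are \<open>\<infinity>\<close> and agree anyway.\<close>

lemma iw_equiv_snd_eq:
  assumes "((f, g), (f', g')) \<in> iw_equiv"
  shows "g \<sigma> = g' \<sigma>"
  using assms unfolding iw_equiv_iff by metis

lemma iw_equiv_fst_eq:
  assumes "((f, g), (f', g')) \<in> iw_equiv" "g \<sigma> \<noteq> \<infinity>"
  shows "f \<sigma> = f' \<sigma>"
  using assms unfolding iw_equiv_iff by metis

lemma iw_limit_unique:
  assumes X: "\<And>n. X n \<in> iw_expectations"
    and L: "L \<in> iw_expectations" "iw_limit X L"
    and M: "M \<in> iw_expectations" "iw_limit X M"
  shows "L = M"
proof -
  obtain f g fs gs where fg: "(f, g) \<in> L" "\<And>n. (fs n, gs n) \<in> X n"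
      "\<And>\<sigma>. (\<lambda>n. gs n \<sigma>) \<longlonglongrightarrow> g \<sigma>"
      "\<And>\<sigma>. g \<sigma> \<noteq> \<infinity> \<Longrightarrow> (\<lambda>n. fs n \<sigma>) \<longlonglongrightarrow> f \<sigma>"
    using L(2) unfolding iw_limit_def by metis
  obtain f' g' fs' gs' where fg': "(f', g') \<in> M" "\<And>n. (fs' n, gs' n) \<in> X n"
      "\<And>\<sigma>. (\<lambda>n. gs' n \<sigma>) \<longlonglongrightarrow> g' \<sigma>"
      "\<And>\<sigma>. g' \<sigma> \<noteq> \<infinity> \<Longrightarrow> (\<lambda>n. fs' n \<sigma>) \<longlonglongrightarrow> f' \<sigma>"
    using M(2) unfolding iw_limit_def by metis
  \<comment> \<open>The two limits may choose different representatives, but both come from the same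
    class \<open>X n\<close>.\<close>
  have equiv: "((fs n, gs n), (fs' n, gs' n)) \<in> iw_equiv" for n
    using quotient_eq_iff[OF equiv_iw_equiv] X fg(2) fg'(2)
    unfolding iw_expectations_def by blast
  have gs_eq: "gs n \<sigma> = gs' n \<sigma>" for n \<sigma>
    using iw_equiv_snd_eq[OF equiv] .
  have g_eq: "g \<sigma> = g' \<sigma>" for \<sigma>
    using LIMSEQ_unique[OF fg(3)] fg'(3) gs_eq by simp
  have f_eq: "f \<sigma> = f' \<sigma>" if fin: "g \<sigma> \<noteq> \<infinity>" for \<sigma>
  proof -
    \<comment> \<open>A finite limit only bounds a tail: finitely many \<open>gs n \<sigma>\<close>
      may be \<open>\<infinity>\<close>, and there \<open>fs n \<sigma>\<close> and
      \<open>fs' n \<sigma>\<close> can differ.\<close>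
    have "\<forall>\<^sub>F n in sequentially. gs n \<sigma> < \<infinity>"
      using order_tendstoD(2)[OF fg(3)] fin by (simp add: less_top)
    then have "\<forall>\<^sub>F n in sequentially. fs n \<sigma> = fs' n \<sigma>"
      by eventually_elim (use iw_equiv_fst_eq[OF equiv] in auto)
    then have "(\<lambda>n. fs' n \<sigma>) \<longlonglongrightarrow> f \<sigma>"
      using fg(4)[OF fin] by (rule Lim_transform_eventually[rotated])
    then show ?thesis
      using LIMSEQ_unique fg'(4) fin g_eq by metis
  qed
  have "(f, g) \<in> iw_pairs" "(f', g') \<in> iw_pairs"
    using in_quotient_imp_subset[OF equiv_iw_equiv] L(1) M(1) fg(1) fg'(1)
    unfolding iw_expectations_def by blast+
  \<comment> \<open>By \<open>g_eq\<close>, \<open>g\<close> and \<open>g'\<close> are infinite at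
    the same points, where \<open>iw_equiv\<close> does not constrain \<open>f\<close> and
    \<open>f'\<close>; elsewhere \<open>f_eq\<close> applies.\<close>
  then have "((f, g), (f', g')) \<in> iw_equiv"
    using f_eq g_eq by (simp add: iw_equiv_iff)
  then show ?thesis
    using quotient_eqI[OF equiv_iw_equiv] L(1) M(1) fg(1) fg'(1)
    unfolding iw_expectations_def by blast
qed

theorem theorem2:
  fixes fs :: "nat \<Rightarrow> 's \<Rightarrow> real" and gs :: "nat \<Rightarrow> 's \<Rightarrow> ennreal"
  assumes "\<And>n. (fs n, gs n) \<in> iw_pairs"
    and "\<exists>L\<in>iw_expectations. iw_limit (\<lambda>n. iw_class (fs n, gs n)) L"
  shows "\<exists>!L\<in>iw_expectations. iw_limit (\<lambda>n. iw_class (fs n, gs n)) L"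
proof -
  \<comment> \<open>Each \<open>iw_class\<close> is a genuine quotient element, so the uniqueness
    lemma for arbitrary sequences of classes applies.\<close>
  have "iw_class (fs n, gs n) \<in> iw_expectations" for n
    unfolding iw_class_def iw_expectations_def using assms(1) by (rule quotientI)
  then show ?thesis
    using assms(2) iw_limit_unique[of "\<lambda>n. iw_class (fs n, gs n)"] by blast
qed

end
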